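(* Let $q\ge2$ be an integer and let $\theta$ be a $q$-multiplicative sequence taking only finitely many values. If Condition (C) holds for $\theta$, then there exist $0<\delta<1$ and a constant $K$ such that $$\sup_{x\in\mathbb R}\left|\sum_{n=0}^{N-1}\theta(n)e^{2i\pi nx}\right|\le K N^{\delta}\qquad\text{for all }N\in\mathbb N.$$
   Context: $\mathbb N=\{0,1,2,\dots\}$. For an integer $q\ge2$, a $q$-multiplicative sequence is a sequence $\theta=(\theta(n))_{n\in\mathbb N}$ of complex numbers of modulus $1$ such that for all integers $t\ge1$ and all $(a,b)\in\mathbb N^2$ with $b<q^t$, $\theta(aq^t+b)=\theta(aq^t)\theta(b)$. Condition (C): for $n\in\mathbb N$ and $0\le j<q$ write $\theta(jq^n)=e^{2i\pi b_{n,j}}$ with $0\le b_{n,j}<1$ (so $b_{n,0}=0$). Write $r\equiv s$ when $r-s\in\mathbb Z$. Let $M$ be the set of $n\in\mathbb N$ such that $\sup_{x\in[0,1)}\left|\sum_{j=0}^{q-1}\theta(jq^n)e^{2i\pi jq^nx}\right|=q$, and for $n\in M$ let $x_n\equiv-b_{n,1}$ be the unique solution modulo $1$ of $\left|\sum_{j=0}^{q-1}\theta(jq^n)e^{2i\pi jx}\right|=q$. Let $I=\{n\in M: n+1\in M,\ qx_n\equiv x_{n+1}\}$; equivalently, $I$ is the set of $n\in\mathbb N$ such that $b_{n,j}\equiv j\,b_{n,1}$ and $b_{n+1,j}\equiv jq\,b_{n,1}$ for all $0\le j\le q-1$. Then $\theta$ satisfies Condition (C) if there exists $\alpha<1$ such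 that $\limsup_{N\to+\infty}\frac{\#(I\cap\{0,\dots,N-1\})}{N}\le\alpha$. *)

theory Defs
  imports "HOL-Analysis.Analysis"
begin

definition q_multiplicative :: "nat \<Rightarrow> (nat \<Rightarrow> complex) \<Rightarrow> bool" where
  "q_multiplicative q \<theta> \<longleftrightarrow>
     (\<forall>n. cmod (\<theta> n) = 1) \<and>
     (\<forall>t a b. 1 \<le> t \<longrightarrow> b < q ^ t \<longrightarrow> \<theta> (a * q ^ t + b) = \<theta> (a * q ^ t) * \<theta> b)"

definition phase :: "nat \<Rightarrow> (nat \<Rightarrow> complex) \<Rightarrow> nat \<Rightarrow> nat \<Rightarrow> real" where
  "phase q \<theta> n j =
     (THE b. 0 \<le> b \<and> b < 1 \<and> \<theta> (j * q ^ n) = exp (2 * \<i> * complex_of_real (pi * b)))"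

definition digit_sum :: "nat \<Rightarrow> (nat \<Rightarrow> complex) \<Rightarrow> nat \<Rightarrow> real \<Rightarrow> complex" where
  "digit_sum q \<theta> n x =
     (\<Sum>j<q. \<theta> (j * q ^ n) * exp (2 * \<i> * complex_of_real (pi * (real j * x))))"

definition cong_1 :: "real \<Rightarrow> real \<Rightarrow> bool" where
  "cong_1 r s \<longleftrightarrow> r - s \<in> \<int>"

definition peak_levels :: "nat \<Rightarrow> (nat \<Rightarrow> complex) \<Rightarrow> nat set" where
  "peak_levels q \<theta> =
     {n. (SUP x\<in>{0..<1}. cmod (digit_sum q \<theta> n (real (q ^ n) * x))) = real q}"

text \<open>With \<open>M\<close> for \<^const>\<open>peak_levels\<close>, \<open>x\<^sub>n\<close> for \<open>peak\<close> and \<open>I\<close> for \<open>resonant\<close>: for \<open>n \<in> M\<close> the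
  solution \<open>x\<^sub>n\<close> is unique only modulo 1, and we take its representative in \<open>[0, 1)\<close>;
  \<open>I\<close> does not depend on this choice.\<close>

definition peak :: "nat \<Rightarrow> (nat \<Rightarrow> complex) \<Rightarrow> nat \<Rightarrow> real" where
  "peak q \<theta> n = (THE x. 0 \<le> x \<and> x < 1 \<and> cmod (digit_sum q \<theta> n x) = real q)"

definition resonant :: "nat \<Rightarrow> (nat \<Rightarrow> complex) \<Rightarrow> nat set" where
  "resonant q \<theta> =
     {n \<in> peak_levels q \<theta>. Suc n \<in> peak_levels q \<theta> \<and>
        cong_1 (real q * peak q \<theta> n) (peak q \<theta> (Suc n))}"

definition condition_C :: "nat \<Rightarrow> (nat \<Rightarrow> complex) \<Rightarrow> bool" where
  "condition_C q \<theta> \<longleftrightarrow>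
     (\<exists>\<alpha>::real. \<alpha> < 1 \<and>
        limsup (\<lambda>N. ereal (real (card (resonant q \<theta> \<inter> {..<N})) / real N)) \<le> ereal \<alpha>)"

lemma phase:
  assumes "q_multiplicative q \<theta>"
  shows "0 \<le> phase q \<theta> n j" "phase q \<theta> n j < 1"
    "\<theta> (j * q ^ n) = exp (2 * \<i> * complex_of_real (pi * phase q \<theta> n j))"
proof -
  define z where "z = \<theta> (j * q ^ n)"
  have z: "cmod z = 1" using assms by (simp add: z_def q_multiplicative_def)
  have ex: "\<exists>!b. 0 \<le> b \<and> b < 1 \<and> z = exp (2 * \<i> * complex_of_real (pi * b))"
  proof (rule ex1I)
    show "0 \<le> Arg2pi z / (2 * pi) \<and> Arg2pi z / (2 * pi) < 1 \<and>
        z = exp (2 * \<i> * complex_of_real (pi * (Arg2pi z / (2 * pi))))"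
      using Arg2pi[of z] z by (simp add: field_simps is_Arg_def)
  next
    fix b :: real
    assume b: "0 \<le> b \<and> b < 1 \<and> z = exp (2 * \<i> * complex_of_real (pi * b))"
    have "Arg2pi z = 2 * pi * b"
      by (rule Arg2pi_unique[of 1]) (use b in \<open>auto simp: algebra_simps\<close>)
    then show "b = Arg2pi z / (2 * pi)" by simp
  qed
  show "0 \<le> phase q \<theta> n j" "phase q \<theta> n j < 1"
    "\<theta> (j * q ^ n) = exp (2 * \<i> * complex_of_real (pi * phase q \<theta> n j))"
    using theI'[OF ex] by (auto simp: phase_def z_def)
qed

lemma exp_2pi_eq_1_iff: "exp (2 * \<i> * complex_of_real (pi * t)) = 1 \<longleftrightarrow> t \<in> \<int>"
proof -
  have "exp (2 * \<i> * complex_of_real (pi * t)) = 1 \<longleftrightarrow> (\<exists>n::int. 2 * pi * t = of_int (2 * n) * pi)"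
    by (simp add: exp_eq_1 algebra_simps)
  also have "\<dots> \<longleftrightarrow> (\<exists>n::int. t = of_int n)" by (simp add: field_simps)
  finally show ?thesis by (auto elim: Ints_cases)
qed

lemma exp_2pi_cong:
  assumes "s - t \<in> \<int>"
  shows "exp (2 * \<i> * complex_of_real (pi * s)) = exp (2 * \<i> * complex_of_real (pi * t))"
proof -
  have "exp (2 * \<i> * complex_of_real (pi * s))
      = exp (2 * \<i> * complex_of_real (pi * t)) * exp (2 * \<i> * complex_of_real (pi * (s - t)))"
    by (simp add: exp_add [symmetric] algebra_simps)
  then show ?thesis using assms by (simp only: exp_2pi_eq_1_iff[THEN iffD2]) simp
qed

lemma norm_sum_unit_eq_card:
  fixes z :: "nat \<Rightarrow> complex"
  assumes nz: "\<And>j. j < q \<Longrightarrow> cmod (z j) = 1" and z0: "z 0 = 1" and q: "q \<ge> 1"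
    and s: "cmod (\<Sum>j<q. z j) = real q" and j: "j < q"
  shows "z j = 1"
proof -
  define S where "S = (\<Sum>j<q. z j)"
  define u where "u = S / of_nat q"
  have u: "cmod u = 1" using s q by (simp add: u_def S_def norm_divide)
  then have uu: "u * cnj u = 1" by (simp add: complex_norm_square[symmetric])
  have "S = of_nat q * u" using q by (simp add: u_def)
  then have "(\<Sum>j<q. z j * cnj u) = of_nat q * (u * cnj u)"
    unfolding sum_distrib_right[symmetric] S_def[symmetric] by (simp only: mult.assoc)
  then have "(\<Sum>j<q. Re (z j * cnj u)) = real q"
    unfolding uu by (metis Re_sum complex_Re_of_nat mult.right_neutral)
  then have sum0: "(\<Sum>j<q. 1 - Re (z j * cnj u)) = 0" by (simp add: sum_subtractf)
  have n1: "cmod (z j * cnj u) = 1" if "j < q" for j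
    using nz[OF that] u by (simp add: norm_mult)
  have "\<And>j. j < q \<Longrightarrow> 0 \<le> 1 - Re (z j * cnj u)"
    using n1 by (metis complex_Re_le_cmod diff_ge_0_iff_ge)
  then have re: "Re (z j * cnj u) = 1" if "j < q" for j
    using sum_nonneg_eq_0_iff[of "{..<q}" "\<lambda>j. 1 - Re (z j * cnj u)"] sum0 that by force
  have one: "z j * cnj u = 1" if "j < q" for j
  proof -
    have "(Re (z j * cnj u))\<^sup>2 + (Im (z j * cnj u))\<^sup>2 = 1"
      using n1[OF that] by (metis cmod_power2 one_power2)
    then show ?thesis using re[OF that] by (intro complex_eqI) auto
  qed
  have "cnj u = 1" using one[of 0] z0 q by simp
  then show ?thesis using one[OF j] by simp
qed

lemma norm_digit_sum_le:
  assumes "q_multiplicative q \<theta>"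
  shows "cmod (digit_sum q \<theta> n x) \<le> real q"
proof -
  have "cmod (digit_sum q \<theta> n x) \<le> (\<Sum>j<q. 1)"
    unfolding digit_sum_def
    by (rule sum_norm_le) (use assms in \<open>simp add: q_multiplicative_def norm_mult\<close>)
  then show ?thesis by simp
qed

lemma norm_digit_sum_eq_iff:
  assumes "q \<ge> 2" and qm: "q_multiplicative q \<theta>"
  shows "cmod (digit_sum q \<theta> n x) = real q \<longleftrightarrow>
    (\<forall>j<q. cong_1 (phase q \<theta> n j) (- (real j * x)))"
proof -
  define z where "z j = \<theta> (j * q ^ n) * exp (2 * \<i> * complex_of_real (pi * (real j * x)))" for j
  have "\<theta> (0 * q ^ 1 + 0) = \<theta> (0 * q ^ 1) * \<theta> 0"
    using qm assms(1) unfolding q_multiplicative_def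
    by (elim conjE allE[of _ 1] allE[of _ 0]) simp
  moreover have "cmod (\<theta> 0) = 1" using qm by (simp add: q_multiplicative_def)
  ultimately have "\<theta> 0 = 1" by force
  then have z0: "z 0 = 1" by (simp add: z_def)
  have nz: "cmod (z j) = 1" for j
    using qm by (simp add: z_def q_multiplicative_def norm_mult)
  have "z j = exp (2 * \<i> * complex_of_real (pi * (phase q \<theta> n j + real j * x)))" for j
    unfolding z_def phase(3)[OF qm] by (simp add: exp_add [symmetric] algebra_simps)
  then have zi: "z j = 1 \<longleftrightarrow> cong_1 (phase q \<theta> n j) (- (real j * x))" for j
    by (simp only: exp_2pi_eq_1_iff cong_1_def) simp
  have "cmod (\<Sum>j<q. z j) = real q \<longleftrightarrow> (\<forall>j<q. z j = 1)"
  proof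
    assume s: "cmod (\<Sum>j<q. z j) = real q"
    show "\<forall>j<q. z j = 1"
      using norm_sum_unit_eq_card[OF nz z0 _ s] assms(1) by simp
  qed simp
  moreover have "digit_sum q \<theta> n x = (\<Sum>j<q. z j)" by (simp only: digit_sum_def z_def)
  ultimately show ?thesis by (simp add: zi)
qed

lemma digit_sum_frac: "digit_sum q \<theta> n (frac x) = digit_sum q \<theta> n x"
  unfolding digit_sum_def
proof (intro sum.cong refl arg_cong2[where f = times] exp_2pi_cong)
  fix j
  have "real j * frac x - real j * x = of_int (- (int j * \<lfloor>x\<rfloor>))"
    by (simp add: frac_def algebra_simps)
  then show "real j * frac x - real j * x \<in> \<int>" by (metis Ints_of_int)
qed

lemma peak_levels_iff:
  assumes "q \<ge> 2" and qm: "q_multiplicative q \<theta>"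
  shows "n \<in> peak_levels q \<theta> \<longleftrightarrow> (\<exists>x. cmod (digit_sum q \<theta> n x) = real q)"
proof -
  define f where "f x = cmod (digit_sum q \<theta> n (real (q ^ n) * x))" for x
  have le: "f x \<le> real q" for x using norm_digit_sum_le[OF qm] by (simp add: f_def)
  have bdd: "bdd_above (f ` {0..<1})" by (rule bdd_aboveI2) (rule le)
  have fe: "f 1 = f 0"
    using digit_sum_frac[of q \<theta> n "real (q ^ n)"] by (simp add: f_def frac_def)
  have "continuous_on {0..1} f"
    unfolding f_def digit_sum_def by (intro continuous_intros)
  then obtain m where m: "m \<in> {0..1}" "\<And>y. y \<in> {0..1} \<Longrightarrow> f y \<le> f m"
    using continuous_attains_sup[of "{0..1::real}" f] by auto
  show ?thesis
  proof
    assume "n \<in> peak_levels q \<theta>"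
    then have S: "(SUP x\<in>{0..<1}. f x) = real q" by (simp add: peak_levels_def f_def)
    have "(SUP x\<in>{0..<1}. f x) \<le> f m" using m(2) by (intro cSUP_least) auto
    then have "f m = real q" using le[of m] S by simp
    then show "\<exists>x. cmod (digit_sum q \<theta> n x) = real q" by (auto simp: f_def)
  next
    assume "\<exists>x. cmod (digit_sum q \<theta> n x) = real q"
    then obtain x where x: "cmod (digit_sum q \<theta> n x) = real q" by blast
    define y where "y = frac x / real (q ^ n)"
    have q1: "1 \<le> real (q ^ n)" using assms(1) by simp
    have y: "y \<in> {0..<1}"
      using less_le_trans[OF frac_lt_1[of x] q1] q1 by (simp add: y_def divide_less_eq)
    have "f y = real q" using assms(1) q1 x digit_sum_frac[of q \<theta> n x] by (simp add: f_def y_def)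
    then have "real q \<le> (SUP x\<in>{0..<1}. f x)" using cSUP_upper[OF y bdd] by simp
    moreover have "(SUP x\<in>{0..<1}. f x) \<le> real q" using le by (intro cSUP_least) auto
    ultimately show "n \<in> peak_levels q \<theta>" by (simp add: peak_levels_def f_def)
  qed
qed

lemma peak:
  assumes "q \<ge> 2" and qm: "q_multiplicative q \<theta>" and n: "n \<in> peak_levels q \<theta>"
  shows "0 \<le> peak q \<theta> n" "peak q \<theta> n < 1" "cmod (digit_sum q \<theta> n (peak q \<theta> n)) = real q"
    "cong_1 (peak q \<theta> n) (- phase q \<theta> n 1)"
    "cmod (digit_sum q \<theta> n x) = real q \<longleftrightarrow> cong_1 x (peak q \<theta> n)"
proof -
  have c: "cong_1 x (- phase q \<theta> n 1)" if "cmod (digit_sum q \<theta> n x) = real q" for x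
  proof -
    have "cong_1 (phase q \<theta> n 1) (- (real 1 * x))"
      using that assms(1) unfolding norm_digit_sum_eq_iff[OF assms(1) qm]
      by (metis Suc_1 Suc_le_lessD)
    then show ?thesis by (simp add: cong_1_def add.commute)
  qed
  have fe: "frac x = frac y" if "cong_1 x y" for x y
  proof -
    from that obtain k :: int where "x - y = of_int k"
      unfolding cong_1_def by (rule Ints_cases)
    then have "x = y + of_int k" by simp
    then show ?thesis by (simp add: frac_def)
  qed
  obtain x0 where x0: "cmod (digit_sum q \<theta> n x0) = real q"
    using n peak_levels_iff[OF assms(1) qm] by blast
  have "\<exists>!x. 0 \<le> x \<and> x < 1 \<and> cmod (digit_sum q \<theta> n x) = real q"
  proof (rule ex1I)
    show "0 \<le> frac x0 \<and> frac x0 < 1 \<and> cmod (digit_sum q \<theta> n (frac x0)) = real q"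
      using x0 by (simp add: digit_sum_frac frac_lt_1)
  next
    fix x assume x: "0 \<le> x \<and> x < 1 \<and> cmod (digit_sum q \<theta> n x) = real q"
    then have "frac x = x" by (simp add: frac_eq)
    then show "x = frac x0" using fe[OF c[OF x0]] fe[OF c[of x]] x by simp
  qed
  from theI'[OF this]
  show a: "0 \<le> peak q \<theta> n" "peak q \<theta> n < 1" "cmod (digit_sum q \<theta> n (peak q \<theta> n)) = real q"
    by (auto simp: peak_def)
  show b: "cong_1 (peak q \<theta> n) (- phase q \<theta> n 1)" by (rule c[OF a(3)])
  show "cmod (digit_sum q \<theta> n x) = real q \<longleftrightarrow> cong_1 x (peak q \<theta> n)"
  proof
    assume "cmod (digit_sum q \<theta> n x) = real q"
    from Ints_diff[OF c[OF this, unfolded cong_1_def] b[unfolded cong_1_def]]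
    show "cong_1 x (peak q \<theta> n)" by (simp add: cong_1_def)
  next
    assume "cong_1 x (peak q \<theta> n)"
    from fe[OF this] show "cmod (digit_sum q \<theta> n x) = real q"
      using a(3) by (metis digit_sum_frac)
  qed
qed

lemma resonant_iff:
  assumes q: "q \<ge> 2" and qm: "q_multiplicative q \<theta>"
  shows "n \<in> resonant q \<theta> \<longleftrightarrow>
    (\<forall>j<q. cong_1 (phase q \<theta> n j) (real j * phase q \<theta> n 1) \<and>
           cong_1 (phase q \<theta> (Suc n) j) (real j * real q * phase q \<theta> n 1))"
    (is "_ \<longleftrightarrow> ?R")
proof -
  let ?b = "phase q \<theta> n 1"
  have R: "?R \<longleftrightarrow> cmod (digit_sum q \<theta> n (- ?b)) = real q \<and>
      cmod (digit_sum q \<theta> (Suc n) (- (real q * ?b))) = real q"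
    unfolding norm_digit_sum_eq_iff[OF q qm] by (auto simp: mult.assoc)
  have key: "cong_1 (real q * peak q \<theta> n) x \<longleftrightarrow> cong_1 (- (real q * ?b)) x"
    if "n \<in> peak_levels q \<theta>" for x
  proof -
    have "real q * (peak q \<theta> n - - ?b) \<in> \<int>"
      using peak(4)[OF q qm that] unfolding cong_1_def by (intro Ints_mult) auto
    then have d: "real q * peak q \<theta> n + real q * ?b \<in> \<int>" by (simp add: algebra_simps)
    have "real q * peak q \<theta> n - x \<in> \<int> \<longleftrightarrow>
        (real q * peak q \<theta> n - x) - (real q * peak q \<theta> n + real q * ?b) \<in> \<int>"
      using Ints_diff[OF _ d] Ints_add[OF _ d] by (metis diff_add_cancel)
    moreover have "(real q * peak q \<theta> n - x) - (real q * peak q \<theta> n + real q * ?b)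
        = - (real q * ?b) - x" by simp
    ultimately show ?thesis by (simp only: cong_1_def)
  qed
  have p: "n \<in> peak_levels q \<theta> \<longleftrightarrow> cmod (digit_sum q \<theta> n (- ?b)) = real q"
  proof
    assume n: "n \<in> peak_levels q \<theta>"
    have "cong_1 (- ?b) (peak q \<theta> n)"
      using Ints_minus[OF peak(4)[OF q qm n, unfolded cong_1_def]]
      by (simp only: cong_1_def minus_diff_eq)
    then show "cmod (digit_sum q \<theta> n (- ?b)) = real q" using peak(5)[OF q qm n] by simp
  qed (use peak_levels_iff[OF q qm] in blast)
  show ?thesis
    unfolding R resonant_def using p key peak(5)[OF q qm, of "Suc n"] peak_levels_iff[OF q qm, of "Suc n"]
    by auto
qed

end

theory Submission
  imports Defs
begin

text \<open>The exponential sum over \<open>n < q ^ t\<close> is the product of the digit sums \<open>D\<^sub>k (q ^ k x)\<close>, \<open>k < t\<close>.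
  If \<open>k\<close> is not resonant, then \<open>\<bar>D\<^sub>k y\<bar> \<bar>D\<^sub>k\<^sub>+\<^sub>1 (q y)\<bar>\<close> stays below \<open>q\<^sup>2\<close> by compactness, and
  uniformly in \<open>k\<close> because a finitely valued \<open>\<theta>\<close> has only finitely many different digit sums.
  Condition (C) provides a positive proportion of such \<open>k\<close>, whence a power saving for \<open>N = q ^ t\<close>.
  A general \<open>N\<close> is split into blocks according to its base \<open>q\<close> digits.\<close>

section \<open>Exponential sums over base \<open>q\<close> blocks\<close>

definition exp_sum :: "(nat \<Rightarrow> complex) \<Rightarrow> real \<Rightarrow> nat \<Rightarrow> complex" where
  "exp_sum \<theta> x N = (\<Sum>n<N. \<theta> n * exp (2 * \<i> * complex_of_real (pi * (real n * x))))"

lemma norm_exp_2pi [simp]: "cmod (exp (2 * \<i> * complex_of_real (pi * t))) = 1"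
  by (simp add: norm_exp_eq_Re)

lemma q_multiplicative_norm: "q_multiplicative q \<theta> \<Longrightarrow> cmod (\<theta> n) = 1"
  by (simp add: q_multiplicative_def)

lemma q_multiplicative_zero:
  assumes "q_multiplicative q \<theta>" "q \<ge> 2"
  shows "\<theta> 0 = 1"
proof -
  have "\<theta> (0 * q ^ 1 + 0) = \<theta> (0 * q ^ 1) * \<theta> 0"
    using assms unfolding q_multiplicative_def by (elim conjE allE[of _ 1] allE[of _ 0]) simp
  moreover have "\<theta> 0 \<noteq> 0" using q_multiplicative_norm[OF assms(1), of 0] by force
  ultimately show ?thesis by simp
qed

lemma q_multiplicative_block:
  assumes "q_multiplicative q \<theta>" "q \<ge> 2" "b < q ^ t"
  shows "\<theta> (a * q ^ t + b) = \<theta> (a * q ^ t) * \<theta> b"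
proof (cases "t = 0")
  case True
  then show ?thesis using assms q_multiplicative_zero[OF assms(1,2)] by simp
next
  case False
  then show ?thesis using assms by (simp add: q_multiplicative_def)
qed

lemma sum_lessThan_add:
  fixes f :: "nat \<Rightarrow> 'a::comm_monoid_add"
  shows "(\<Sum>n<m + b. f n) = (\<Sum>n<m. f n) + (\<Sum>n<b. f (m + n))"
  by (induction b) (simp_all add: add.assoc)

text \<open>Only indices \<open>n < b\<close> occur in the last sum, so \<open>b = q ^ t\<close> is
  allowed. That case appends one complete block, which drives the induction in
  \<open>exp_sum_mult\<close>.\<close>

lemma exp_sum_block:
  assumes "q_multiplicative q \<theta>" "q \<ge> 2" "b \<le> q ^ t"
  shows "exp_sum \<theta> x (a * q ^ t + b) = exp_sum \<theta> x (a * q ^ t) +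
    \<theta> (a * q ^ t) * exp (2 * \<i> * complex_of_real (pi * (real a * (real (q ^ t) * x)))) * exp_sum \<theta> x b"
proof -
  have "\<theta> (a * q ^ t + n) * exp (2 * \<i> * complex_of_real (pi * (real (a * q ^ t + n) * x))) =
    \<theta> (a * q ^ t) * exp (2 * \<i> * complex_of_real (pi * (real a * (real (q ^ t) * x)))) *
    (\<theta> n * exp (2 * \<i> * complex_of_real (pi * (real n * x))))" if "n < b" for n
  proof -
    have "exp (2 * \<i> * complex_of_real (pi * (real (a * q ^ t + n) * x))) =
      exp (2 * \<i> * complex_of_real (pi * (real a * (real (q ^ t) * x)))) *
      exp (2 * \<i> * complex_of_real (pi * (real n * x)))"
      by (simp add: exp_add [symmetric] algebra_simps)
    then show ?thesis
      using q_multiplicative_block[OF assms(1,2), of n t a] that assms(3) by simp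
  qed
  then show ?thesis
    unfolding exp_sum_def sum_lessThan_add sum_distrib_left by simp
qed

text \<open>Each of the \<open>a\<close> blocks of length \<open>q ^ t\<close> is the first block
  times a unimodular factor. For \<open>a = q\<close> the factors add up to a digit sum, which gives
  the product formula; other values of \<open>a\<close> serve to split a general
  \<open>N\<close>.\<close>

lemma exp_sum_mult:
  assumes "q_multiplicative q \<theta>" "q \<ge> 2"
  shows "exp_sum \<theta> x (a * q ^ t) =
    (\<Sum>j<a. \<theta> (j * q ^ t) * exp (2 * \<i> * complex_of_real (pi * (real j * (real (q ^ t) * x))))) *
    exp_sum \<theta> x (q ^ t)"
proof (induction a)
  case 0
  then show ?case by (simp add: exp_sum_def)
next
  case (Suc a)
  have "exp_sum \<theta> x (Suc a * q ^ t) = exp_sum \<theta> x (a * q ^ t + q ^ t)"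
    by (simp add: add.commute)
  also have "\<dots> = exp_sum \<theta> x (a * q ^ t) + \<theta> (a * q ^ t) *
      exp (2 * \<i> * complex_of_real (pi * (real a * (real (q ^ t) * x)))) * exp_sum \<theta> x (q ^ t)"
    by (rule exp_sum_block[OF assms order_refl])
  finally show ?case by (simp only: Suc.IH sum.lessThan_Suc distrib_right)
qed

lemma exp_sum_power_eq_prod:
  assumes "q_multiplicative q \<theta>" "q \<ge> 2"
  shows "exp_sum \<theta> x (q ^ t) = (\<Prod>k<t. digit_sum q \<theta> k (real (q ^ k) * x))"
proof (induction t)
  case 0
  then show ?case using q_multiplicative_zero[OF assms] by (simp add: exp_sum_def)
next
  case (Suc t)
  have "exp_sum \<theta> x (q ^ Suc t) = digit_sum q \<theta> t (real (q ^ t) * x) * exp_sum \<theta> x (q ^ t)"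
    using exp_sum_mult[OF assms, of x q t] by (simp only: digit_sum_def power_Suc)
  then show ?case by (simp add: Suc.IH mult.commute)
qed

lemma norm_exp_sum_block_le:
  assumes "q_multiplicative q \<theta>" "q \<ge> 2" "b \<le> q ^ t"
  shows "cmod (exp_sum \<theta> x (a * q ^ t + b)) \<le>
    real a * cmod (exp_sum \<theta> x (q ^ t)) + cmod (exp_sum \<theta> x b)"
proof -
  have "cmod (\<Sum>j<a. \<theta> (j * q ^ t) *
      exp (2 * \<i> * complex_of_real (pi * (real j * (real (q ^ t) * x))))) \<le> (\<Sum>j<a. 1)"
    by (rule sum_norm_le) (simp only: norm_mult norm_exp_2pi q_multiplicative_norm[OF assms(1)] mult_1 order_refl)
  then have "cmod (exp_sum \<theta> x (a * q ^ t)) \<le> real a * cmod (exp_sum \<theta> x (q ^ t))"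
    unfolding exp_sum_mult[OF assms(1,2), of x a t] norm_mult
    by (intro mult_right_mono) auto
  moreover have "cmod (exp_sum \<theta> x (a * q ^ t + b)) \<le>
      cmod (exp_sum \<theta> x (a * q ^ t)) + cmod (exp_sum \<theta> x b)"
    unfolding exp_sum_block[OF assms]
    by (rule order_trans[OF norm_triangle_ineq])
      (simp only: norm_mult norm_exp_2pi q_multiplicative_norm[OF assms(1)] mult_1 order_refl)
  ultimately show ?thesis by linarith
qed

text \<open>Peel off the leading base \<open>q\<close> digit: at most \<open>q\<close> full blocks,
  each bounded by \<open>C * g ^ t\<close>, and a remainder below \<open>q ^ t\<close> left to the
  induction.\<close>

lemma norm_exp_sum_le_geometric:
  assumes "q_multiplicative q \<theta>" "q \<ge> 2"
    and "\<And>t. cmod (exp_sum \<theta> x (q ^ t)) \<le> C * g ^ t"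
    and "N < q ^ t"
  shows "cmod (exp_sum \<theta> x N) \<le> real q * C * (\<Sum>k<t. g ^ k)"
  using assms(4)
proof (induction t arbitrary: N)
  case 0
  then show ?case by (simp add: exp_sum_def)
next
  case (Suc t)
  define a b where "a = N div q ^ t" and "b = N mod q ^ t"
  have N: "N = a * q ^ t + b" unfolding a_def b_def by (rule div_mult_mod_eq[symmetric])
  have q0: "q ^ t > 0" using assms(2) by simp
  have b: "b < q ^ t" using q0 by (simp add: b_def)
  have a: "a \<le> q" using Suc.prems less_mult_imp_div_less[of N q "q ^ t"] by (simp add: a_def)
  have "cmod (exp_sum \<theta> x N) \<le> real a * cmod (exp_sum \<theta> x (q ^ t)) + cmod (exp_sum \<theta> x b)"
    unfolding N using norm_exp_sum_block_le[OF assms(1,2)] b by simp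
  also have "\<dots> \<le> real q * (C * g ^ t) + real q * C * (\<Sum>k<t. g ^ k)"
    using a assms(3)[of t] Suc.IH[OF b] by (intro add_mono mult_mono) auto
  finally show ?case by (simp add: algebra_simps)
qed

section \<open>A uniform gap at non-resonant levels\<close>

text \<open>As a function of \<open>x\<close>, a digit sum depends only on its \<open>q\<close>
  coefficients, which come from a finite set.\<close>

lemma finite_range_digit_sum:
  assumes "finite (range \<theta>)"
  shows "finite (range (digit_sum q \<theta>))"
proof (rule finite_subset)
  let ?G = "\<lambda>v x. \<Sum>j<q. v j * exp (2 * \<i> * complex_of_real (pi * (real j * x)))"
  show "finite (?G ` (\<Pi>\<^sub>E j\<in>{..<q}. range \<theta>))"
    by (intro finite_imageI finite_PiE assms) simp
  show "range (digit_sum q \<theta>) \<subseteq> ?G ` (\<Pi>\<^sub>E j\<in>{..<q}. range \<theta>)"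
  proof (rule image_subsetI)
    fix n
    have "digit_sum q \<theta> n = ?G (restrict (\<lambda>j. \<theta> (j * q ^ n)) {..<q})"
      by (rule ext) (simp add: digit_sum_def)
    moreover have "restrict (\<lambda>j. \<theta> (j * q ^ n)) {..<q} \<in> (\<Pi>\<^sub>E j\<in>{..<q}. range \<theta>)" by simp
    ultimately show "digit_sum q \<theta> n \<in> ?G ` (\<Pi>\<^sub>E j\<in>{..<q}. range \<theta>)" by (rule image_eqI)
  qed
qed

text \<open>If the product reached the square of \<open>q\<close> at some \<open>x\<close>, both
  levels would peak there, and this forces resonance. The strict pointwise bound becomes uniform in
  \<open>x\<close> by periodicity and compactness.\<close>

lemma non_resonant_bound:
  assumes "q \<ge> 2" "q_multiplicative q \<theta>" "n \<notin> resonant q \<theta>"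
  shows "\<exists>c<(real q)\<^sup>2. \<forall>x. cmod (digit_sum q \<theta> n x) * cmod (digit_sum q \<theta> (Suc n) (real q * x)) \<le> c"
proof -
  define f where "f x = cmod (digit_sum q \<theta> n x) * cmod (digit_sum q \<theta> (Suc n) (real q * x))" for x
  have le: "cmod (digit_sum q \<theta> k x) \<le> real q" for k x by (rule norm_digit_sum_le[OF assms(2)])
  have lt: "f x < (real q)\<^sup>2" for x
  proof (rule ccontr)
    assume "\<not> f x < (real q)\<^sup>2"
    then have ge: "real q * real q \<le> f x" by (simp add: power2_eq_square)
    \<comment> \<open>Neither factor exceeds \<open>q\<close>, so a product of at least
      \<open>q * q\<close> forces both to equal \<open>q\<close>.\<close>
    have "f x \<le> cmod (digit_sum q \<theta> n x) * real q" "f x \<le> real q * cmod (digit_sum q \<theta> (Suc n) (real q * x))"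
      unfolding f_def by (intro mult_mono le order_refl; simp)+
    then have "real q * real q \<le> cmod (digit_sum q \<theta> n x) * real q"
      "real q * real q \<le> real q * cmod (digit_sum q \<theta> (Suc n) (real q * x))"
      using ge by linarith+
    then have "real q \<le> cmod (digit_sum q \<theta> n x)" "real q \<le> cmod (digit_sum q \<theta> (Suc n) (real q * x))"
      using assms(1) mult_le_cancel_right_pos[of "real q"] mult_le_cancel_left_pos[of "real q"] by auto
    then have eq: "cmod (digit_sum q \<theta> n x) = real q" "cmod (digit_sum q \<theta> (Suc n) (real q * x)) = real q"
      using le[of n x] le[of "Suc n" "real q * x"] by (auto intro: antisym)
    then have n: "n \<in> peak_levels q \<theta>" "Suc n \<in> peak_levels q \<theta>"
      using peak_levels_iff[OF assms(1,2)] by blast+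
    have c: "x - peak q \<theta> n \<in> \<int>" "real q * x - peak q \<theta> (Suc n) \<in> \<int>"
      using peak(5)[OF assms(1,2) n(1)] peak(5)[OF assms(1,2) n(2)] eq by (auto simp: cong_1_def)
    \<comment> \<open>Subtracting \<open>q\<close> times the first congruence from the second
      eliminates \<open>x\<close>.\<close>
    have "(real q * x - peak q \<theta> (Suc n)) - real q * (x - peak q \<theta> n) \<in> \<int>"
      by (intro Ints_diff[OF c(2) Ints_mult[OF _ c(1)]]) simp
    then have "cong_1 (real q * peak q \<theta> n) (peak q \<theta> (Suc n))"
      by (simp add: cong_1_def algebra_simps)
    then show False using n assms(3) by (simp add: resonant_def)
  qed
  have "continuous_on {0..1} f"
    unfolding f_def digit_sum_def by (intro continuous_intros)
  then obtain m where "m \<in> {0..1}" and m: "\<And>y. y \<in> {0..1} \<Longrightarrow> f y \<le> f m"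
    using continuous_attains_sup[of "{0..1::real}" f] by auto
  \<comment> \<open>Period 1: modulo 1, \<open>real q * x\<close> depends only on \<open>x\<close>
    modulo 1, because \<open>q\<close> is an integer. Hence the maximum over the unit interval is
    global.\<close>
  have "f x = f (frac x)" for x
  proof -
    have "frac (real q * frac x) = frac (real q * x)"
    proof -
      have "real q * x = real q * frac x + of_int (int q * \<lfloor>x\<rfloor>)"
        by (simp add: frac_def algebra_simps)
      then show ?thesis by (metis frac_add_of_int_right)
    qed
    then show ?thesis unfolding f_def by (metis digit_sum_frac)
  qed
  then have "f x \<le> f m" for x using m[of "frac x"] by (simp add: frac_lt_1 less_imp_le)
  then show ?thesis using lt[of m] unfolding f_def by blast
qed

lemma finite_uniform_strict_bound:
  fixes L :: "'c::{linorder,no_bot}"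
  assumes "finite B" "\<And>p. p \<in> B \<Longrightarrow> \<exists>c<L. \<forall>x. g p x \<le> c"
  shows "\<exists>c<L. \<forall>p\<in>B. \<forall>x. g p x \<le> c"
  using assms
proof (induction B)
  case empty
  then show ?case using lt_ex by auto
next
  case (insert p B)
  obtain c where "c < L" "\<forall>p\<in>B. \<forall>x. g p x \<le> c" using insert by auto
  moreover obtain d where "d < L" "\<forall>x. g p x \<le> d" using insert.prems by auto
  ultimately show ?case by (intro exI[of _ "max c d"]) (auto simp: le_max_iff_disj)
qed

text \<open>The bound for \<open>n\<close> depends only on the pair of functions at levels
  \<open>n\<close> and \<open>Suc n\<close>. Only finitely many pairs occur, so the largest of their
  bounds works for all \<open>n\<close>.\<close>

lemma non_resonant_uniform_bound:
  assumes "q \<ge> 2" "q_multiplicative q \<theta>" "finite (range \<theta>)"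
  shows "\<exists>c<(real q)\<^sup>2. \<forall>n. n \<notin> resonant q \<theta> \<longrightarrow>
    (\<forall>x. cmod (digit_sum q \<theta> n x) * cmod (digit_sum q \<theta> (Suc n) (real q * x)) \<le> c)"
proof -
  let ?B = "(\<lambda>n. (digit_sum q \<theta> n, digit_sum q \<theta> (Suc n))) ` (- resonant q \<theta>)"
  have "?B \<subseteq> range (digit_sum q \<theta>) \<times> range (digit_sum q \<theta>)" by auto
  then have "finite ?B"
    using finite_range_digit_sum[OF assms(3)] by (meson finite_SigmaI finite_subset)
  then have "\<exists>c<(real q)\<^sup>2. \<forall>p\<in>?B. \<forall>x. cmod (fst p x) * cmod (snd p (real q * x)) \<le> c"
    by (rule finite_uniform_strict_bound) (use non_resonant_bound[OF assms(1,2)] in auto)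
  then show ?thesis by auto
qed

section \<open>Power saving at powers of \<open>q\<close>\<close>

text \<open>Squaring the product lets every adjacent pair contribute, so that overlapping pairs of levels
  need not be thinned out.\<close>

lemma prod_power2_le_prod_adjacent:
  fixes d :: "nat \<Rightarrow> real"
  assumes "\<And>k. 0 \<le> d k" "\<And>k. d k \<le> 1"
  shows "(\<Prod>k<Suc t. d k)\<^sup>2 \<le> (\<Prod>k<t. d k * d (Suc k))"
proof -
  \<comment> \<open>Among the adjacent pairs every inner factor occurs twice but the two end factors
    only once; \<open>d 0 * d t\<close> supplies the missing copies.\<close>
  have "(\<Prod>k<Suc t. d k)\<^sup>2 = d 0 * d t * (\<Prod>k<t. d k * d (Suc k))"
  proof (induction t)
    case 0
    then show ?case by (simp add: power2_eq_square)
  next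
    case (Suc t)
    have "(\<Prod>k<Suc (Suc t). d k)\<^sup>2 = (\<Prod>k<Suc t. d k)\<^sup>2 * (d (Suc t))\<^sup>2"
      by (simp only: prod.lessThan_Suc[of _ "Suc t"] power_mult_distrib)
    also have "\<dots> = d 0 * d t * (\<Prod>k<t. d k * d (Suc k)) * (d (Suc t))\<^sup>2"
      by (simp only: Suc.IH)
    finally show ?case by (simp add: power2_eq_square)
  qed
  also have "\<dots> \<le> 1 * (\<Prod>k<t. d k * d (Suc k))"
    using assms by (intro mult_right_mono prod_nonneg mult_le_one) auto
  finally show ?thesis by simp
qed

text \<open>After dividing each digit sum by \<open>q\<close>, a resonant pair is bounded by 1 and a
  non-resonant one by \<open>c\<close>. The \<open>Suc t\<close> levels form \<open>t\<close>
  adjacent pairs, hence the shift between the two sides.\<close>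

lemma norm_exp_sum_power_le:
  assumes "q \<ge> 2" "q_multiplicative q \<theta>" "0 \<le> c"
    and "\<And>n x. n \<notin> resonant q \<theta> \<Longrightarrow>
      cmod (digit_sum q \<theta> n x) * cmod (digit_sum q \<theta> (Suc n) (real q * x)) \<le> c * (real q)\<^sup>2"
  shows "(cmod (exp_sum \<theta> x (q ^ Suc t)))\<^sup>2 \<le> (real q ^ Suc t)\<^sup>2 * c ^ card ({..<t} - resonant q \<theta>)"
proof -
  define d where "d k = cmod (digit_sum q \<theta> k (real (q ^ k) * x)) / real q" for k
  have q: "real q > 0" using assms(1) by simp
  have d: "0 \<le> d k" "d k \<le> 1" for k
    using norm_digit_sum_le[OF assms(2)] q by (auto simp: d_def)
  have "cmod (exp_sum \<theta> x (q ^ Suc t)) = real q ^ Suc t * (\<Prod>k<Suc t. d k)"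
    unfolding exp_sum_power_eq_prod[OF assms(2,1)] d_def prod_dividef prod_norm
    using q by simp
  then have "(cmod (exp_sum \<theta> x (q ^ Suc t)))\<^sup>2 = (real q ^ Suc t)\<^sup>2 * (\<Prod>k<Suc t. d k)\<^sup>2"
    by (simp only: power_mult_distrib)
  also have "(\<Prod>k<Suc t. d k)\<^sup>2 \<le> (\<Prod>k<t. d k * d (Suc k))"
    by (rule prod_power2_le_prod_adjacent[OF d])
  also have "\<dots> \<le> (\<Prod>k<t. if k \<in> resonant q \<theta> then 1 else c)"
  proof (rule prod_mono, intro conjI)
    fix k
    show "0 \<le> d k * d (Suc k)" using d by simp
    show "d k * d (Suc k) \<le> (if k \<in> resonant q \<theta> then 1 else c)"
    proof (cases "k \<in> resonant q \<theta>")
      case True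
      then show ?thesis using d by (simp add: mult_le_one)
    next
      case False
      have "real (q ^ Suc k) * x = real q * (real (q ^ k) * x)" by simp
      then show ?thesis
        using False assms(4)[OF False, of "real (q ^ k) * x"] q
        by (simp only: d_def) (simp add: field_simps power2_eq_square)
    qed
  qed
  also have "\<dots> = c ^ card ({..<t} - resonant q \<theta>)"
    by (simp add: prod.If_cases Diff_eq)
  finally show ?thesis by (simp add: mult_left_mono)
qed

lemma condition_C_card_non_resonant:
  assumes "condition_C q \<theta>"
  shows "\<exists>\<beta>>0. \<exists>B. \<forall>t. \<beta> * real t - B \<le> real (card ({..<t} - resonant q \<theta>))"
proof -
  obtain \<alpha> :: real where \<alpha>: "\<alpha> < 1"
    "limsup (\<lambda>N. ereal (real (card (resonant q \<theta> \<inter> {..<N})) / real N)) \<le> ereal \<alpha>"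
    using assms by (auto simp: condition_C_def)
  \<comment> \<open>The strict inequality leaves room to pass from the limsup to all large
    \<open>N\<close>.\<close>
  obtain \<alpha>' where \<alpha>': "\<alpha> < \<alpha>'" "\<alpha>' < 1" using dense[OF \<alpha>(1)] by auto
  have "limsup (\<lambda>N. ereal (real (card (resonant q \<theta> \<inter> {..<N})) / real N)) < ereal \<alpha>'"
    using \<alpha>(2) \<alpha>'(1) by (meson ereal_less_eq(3) ereal_less(2) le_less_trans less_ereal.simps(1))
  then have "eventually (\<lambda>N. ereal (real (card (resonant q \<theta> \<inter> {..<N})) / real N) < ereal \<alpha>') sequentially"
    by (rule Limsup_lessD)
  then obtain T where T: "\<And>N. N \<ge> T \<Longrightarrow> real (card (resonant q \<theta> \<inter> {..<N})) / real N < \<alpha>'"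
    by (auto simp: eventually_sequentially)
  \<comment> \<open>The subtracted constant makes the left side nonpositive for \<open>t\<close> up
    to \<open>T\<close>, so the bound holds without a threshold.\<close>
  have "(1 - \<alpha>') * real t - (1 - \<alpha>') * real T \<le> real (card ({..<t} - resonant q \<theta>))" for t
  proof (cases "t \<ge> T \<and> t > 0")
    case True
    have "card ({..<t} - resonant q \<theta>) + card (resonant q \<theta> \<inter> {..<t}) = card {..<t}"
      using card_Diff_subset_Int[of "{..<t}" "resonant q \<theta>"]
        card_mono[of "{..<t}" "resonant q \<theta> \<inter> {..<t}"] by (simp add: Int_commute)
    moreover have "real (card (resonant q \<theta> \<inter> {..<t})) \<le> \<alpha>' * real t"
      using T[of t] True by (simp add: divide_less_eq)
    moreover have "0 \<le> (1 - \<alpha>') * real T" using \<alpha>' by simp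
    ultimately show ?thesis by (simp add: algebra_simps)
  next
    case False
    then have "(1 - \<alpha>') * real t \<le> (1 - \<alpha>') * real T" using \<alpha>' by (intro mult_left_mono) auto
    then show ?thesis by linarith
  qed
  then show ?thesis using \<alpha>'(2) by (intro exI[of _ "1 - \<alpha>'"]) auto
qed

lemma exp_sum_power_saving:
  assumes "q \<ge> 2" "q_multiplicative q \<theta>" "finite (range \<theta>)" "condition_C q \<theta>"
  shows "\<exists>\<delta> C. 0 < \<delta> \<and> \<delta> < 1 \<and> 0 < C \<and> (\<forall>x t. cmod (exp_sum \<theta> x (q ^ t)) \<le> C * (real q powr \<delta>) ^ t)"
proof -
  have q: "real q > 1" using assms(1) by simp
  obtain c0 where c0: "c0 < (real q)\<^sup>2" "\<And>n x. n \<notin> resonant q \<theta> \<Longrightarrow>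
      cmod (digit_sum q \<theta> n x) * cmod (digit_sum q \<theta> (Suc n) (real q * x)) \<le> c0"
    using non_resonant_uniform_bound[OF assms(1-3)] by blast
  \<comment> \<open>The floor 1/2 keeps \<open>c\<close> positive, so that its logarithm can be
    used, and still below 1.\<close>
  define c where "c = max (1 / 2) (c0 / (real q)\<^sup>2)"
  have c: "0 < c" "c < 1" using c0(1) q by (auto simp: c_def)
  have c0c: "c0 \<le> c * (real q)\<^sup>2"
    using q by (simp add: c_def max_def field_simps)
  obtain \<beta> B where \<beta>: "\<beta> > 0" "\<And>t. \<beta> * real t - B \<le> real (card ({..<t} - resonant q \<theta>))"
    using condition_C_card_non_resonant[OF assms(4)] by blast
  define \<kappa> where "\<kappa> = - log (real q) c"
  have \<kappa>: "\<kappa> > 0" using c q by (simp add: \<kappa>_def log_less_zero_cancel_iff)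
  have cq: "c = real q powr - \<kappa>" using c q by (simp add: \<kappa>_def)
  \<comment> \<open>The squared sum gains \<open>\<kappa> * \<beta>\<close> in the exponent per
    level, so the sum itself gains half of that. The cap 1/2 keeps the final exponent
    \<open>1 - \<epsilon>\<close> positive.\<close>
  define \<epsilon> where "\<epsilon> = min (1 / 2) (\<kappa> * \<beta> / 2)"
  have \<epsilon>: "0 < \<epsilon>" "\<epsilon> < 1" "2 * \<epsilon> \<le> \<kappa> * \<beta>" using \<kappa> \<beta>(1) by (auto simp: \<epsilon>_def)
  \<comment> \<open>\<open>\<kappa> * B\<close> pays for the offset in the count of non-resonant
    levels, and 2 exceeds the loss \<open>2 * \<epsilon>\<close> from having only
    \<open>t - 1\<close> pairs. Nonnegativity of \<open>D\<close> covers
    \<open>t = 0\<close>.\<close>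
  define D where "D = max 0 ((\<kappa> * B + 2) / 2)"
  have "cmod (exp_sum \<theta> x (q ^ t)) \<le> real q powr D * (real q powr (1 - \<epsilon>)) ^ t" for x t
  proof (cases t)
    case 0
    have "exp_sum \<theta> x (q ^ 0) = 1"
      using exp_sum_power_eq_prod[OF assms(2,1), of x 0] by simp
    moreover have "1 \<le> real q powr D" using q by (simp add: ge_one_powr_ge_zero D_def)
    ultimately show ?thesis by (simp add: 0)
  next
    case (Suc s)
    let ?m = "card ({..<s} - resonant q \<theta>)"
    have "(cmod (exp_sum \<theta> x (q ^ t)))\<^sup>2 \<le> (real q ^ t)\<^sup>2 * c ^ ?m"
      unfolding Suc
      by (rule norm_exp_sum_power_le[OF assms(1,2)]) (use c c0(2) c0c in \<open>auto intro: order_trans\<close>)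
    also have "\<dots> = real q powr (2 * real t + - \<kappa> * real ?m)"
    proof -
      have "(real q ^ t)\<^sup>2 = real q powr (2 * real t)"
        using q by (simp add: powr_realpow[symmetric] powr_powr mult.commute)
      moreover have "c ^ ?m = real q powr (- \<kappa> * real ?m)"
        using q by (subst cq) (simp add: powr_powr powr_realpow[symmetric])
      ultimately show ?thesis by (simp only: powr_add)
    qed
    also have "\<dots> \<le> real q powr (2 * (D + (1 - \<epsilon>) * real t))"
    proof (rule powr_mono)
      have "\<kappa> * (\<beta> * real s - B) \<le> \<kappa> * real ?m" using \<beta>(2) \<kappa> by (intro mult_left_mono) auto
      moreover have "2 * \<epsilon> * real s \<le> \<kappa> * \<beta> * real s" using \<epsilon>(3) by (intro mult_right_mono) auto
      moreover have "\<kappa> * B + 2 \<le> 2 * D" by (simp add: D_def max_def field_simps)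
      ultimately show "2 * real t + - \<kappa> * real ?m \<le> 2 * (D + (1 - \<epsilon>) * real t)"
        using \<epsilon> by (simp add: Suc algebra_simps)
    qed (use q in simp)
    also have "\<dots> = (real q powr D * (real q powr (1 - \<epsilon>)) ^ t)\<^sup>2"
    proof -
      have "real q powr D * (real q powr (1 - \<epsilon>)) ^ t = real q powr (D + (1 - \<epsilon>) * real t)"
        using q by (simp add: powr_add powr_powr powr_realpow[symmetric])
      then show ?thesis by (simp only: power2_eq_square powr_add[symmetric] mult_2)
    qed
    finally show ?thesis by (rule power2_le_imp_le) simp
  qed
  then show ?thesis
    using \<epsilon> q by (intro exI[of _ "1 - \<epsilon>"] exI[of _ "real q powr D"]) auto
qed

section \<open>Passage to general \<open>N\<close>\<close>

theorem theorem10: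
  fixes q :: nat and \<theta> :: "nat \<Rightarrow> complex"
  assumes "q \<ge> 2"
    and "q_multiplicative q \<theta>"
    and "finite (range \<theta>)"
    and "condition_C q \<theta>"
  shows "\<exists>\<delta> K :: real. 0 < \<delta> \<and> \<delta> < 1 \<and>
    (\<forall>N::nat. (SUP x::real. cmod (\<Sum>n<N. \<theta> n * exp (2 * \<i> * complex_of_real (pi * (real n * x)))))
               \<le> K * real N powr \<delta>)"
proof -
  obtain \<delta> C where \<delta>: "0 < \<delta>" "\<delta> < 1" and C: "0 < C"
    and S: "\<And>x t. cmod (exp_sum \<theta> x (q ^ t)) \<le> C * (real q powr \<delta>) ^ t"
    using exp_sum_power_saving[OF assms] by blast
  define g where "g = real q powr \<delta>"
  have q: "real q > 1" using assms(1) by simp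
  have g: "g > 1" using q \<delta> by (simp add: g_def gr_one_powr)
  \<comment> \<open>\<open>real q * C\<close> comes from the digit blocks, and
    \<open>g / (g - 1)\<close> compares a geometric sum with its last term.\<close>
  define K where "K = real q * C * (g / (g - 1))"
  have "cmod (exp_sum \<theta> x N) \<le> K * real N powr \<delta>" for x N
  proof (cases "N = 0")
    case True
    then show ?thesis by (simp add: exp_sum_def)
  next
    case False
    \<comment> \<open>With \<open>t\<close> the position of the leading digit of \<open>N\<close>,
      the last term \<open>g ^ t\<close> is the power \<open>\<delta>\<close> of
      \<open>q ^ t\<close>, hence at most that of \<open>N\<close>.\<close>
    then obtain t where t: "q ^ t \<le> N" "N < q ^ Suc t"
      using ex_power_ivl1[of q N] assms(1) by auto
    have "(\<Sum>k<Suc t. g ^ k) = (g ^ Suc t - 1) / (g - 1)"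
      using g by (subst geometric_sum) auto
    also have "\<dots> \<le> g / (g - 1) * g ^ t" using g by (simp add: divide_right_mono)
    also have "g ^ t = real (q ^ t) powr \<delta>"
      using q by (simp add: g_def powr_realpow[symmetric] powr_powr mult.commute)
    also have "\<dots> \<le> real N powr \<delta>" using t(1) \<delta> by (intro powr_mono2) auto
    finally have "(\<Sum>k<Suc t. g ^ k) \<le> g / (g - 1) * real N powr \<delta>"
      using g by (simp add: divide_right_mono)
    then have "real q * C * (\<Sum>k<Suc t. g ^ k) \<le> real q * C * (g / (g - 1) * real N powr \<delta>)"
      using C by (intro mult_left_mono) auto
    moreover have "cmod (exp_sum \<theta> x N) \<le> real q * C * (\<Sum>k<Suc t. g ^ k)"
      by (rule norm_exp_sum_le_geometric[OF assms(2,1) _ t(2)]) (use S in \<open>simp add: g_def\<close>)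
    ultimately show ?thesis by (simp only: K_def mult.assoc)
  qed
  then have "(SUP x. cmod (exp_sum \<theta> x N)) \<le> K * real N powr \<delta>" for N
    by (intro cSUP_least) auto
  then show ?thesis using \<delta> unfolding exp_sum_def by blast
qed

end
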